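(* Let $P=(V_P,E_P)$ be a simple weakly-connected directed graph with a constant number of vertices, let $m\ge1$ and $\lambda\in[1,m]$ be integers, and let $$\mathsf{DC}=\bigcup_{(X,Y)\in E_P}\big\{(\emptyset,\{X,Y\},m),\ (\{X\},\{X,Y\},\lambda)\big\}$$ (a set of degree constraints over $V_P$, whose constraint dependency graph is exactly $P$). If $\mathsf{DC}$ is cyclic (that is, $P$ contains a directed cycle), then there exists an acyclic subset $\mathsf{DC}'\subset\mathsf{DC}$ satisfying $$\mathit{polymat}(\mathsf{DC}')=\Theta(\mathit{polymat}(\mathsf{DC})),$$ where the constants hidden in $\Theta(\cdot)$ depend only on $P$ (not on $m$ or $\lambda$).
   Context: **Degree constraints.** A degree constraint over a finite set $\mathcal{S}$ is a triple $(\mathcal{X},\mathcal{Y},N_{\mathcal{Y}\mid\mathcal{X}})$ with $\mathcal{X}\subsetneq\mathcal{Y}\subseteq\mathcal{S}$ and $N_{\mathcal{Y}\mid\mathcal{X}}\ge1$ an integer. **Acyclicity.** The constraint dependency graph of a set $\mathsf{C}$ of degree constraints over $\mathcal{S}$ is the directed graph with vertex set $\mathcal{S}$ having an edge $(X,Y)$ for every $(\mathcal{X},\mathcal{Y},N)\in\mathsf{C}$ with $\mathcal{X}\ne\emptyset$ and every $(X,Y)\in\mathcal{X}\times(\mathcal{Y}\setminus\mathcal{X})$. $\mathsf{C}$ is acyclic if this graph has no directed cycle, and cyclic otherwise. Simple directed graphs have no self-loops and no parallel edges, but may contain both $(X,Y)$ and $(Y,X)$. **Polymatroid bound.** $$\mathit{polymat}(\mathsf{C})=2^{\max_h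 h(\mathcal{S})},$$ where $h$ ranges over all functions $h:2^{\mathcal{S}}\to\mathbb{R}_{\ge0}$ that satisfy $h(\emptyset)=0$, are monotone, submodular ($h(\mathcal{X}\cup\mathcal{Y})+h(\mathcal{X}\cap\mathcal{Y})\le h(\mathcal{X})+h(\mathcal{Y})$ for all $\mathcal{X},\mathcal{Y}\subseteq\mathcal{S}$), and satisfy $h(\mathcal{Y})-h(\mathcal{X})\le\log_2 N_{\mathcal{Y}\mid\mathcal{X}}$ for every $(\mathcal{X},\mathcal{Y},N_{\mathcal{Y}\mid\mathcal{X}})\in\mathsf{C}$. (If the maximum does not exist because the values are unbounded, the bound is $+\infty$.) *)

theory Defs
  imports "HOL-Analysis.Analysis" "Graph_Theory.Graph_Theory"
begin

type_synonym 'a degree_constraint = "'a set \<times> 'a set \<times> nat"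

definition degree_constraints :: "'a set \<Rightarrow> 'a degree_constraint set" where
  "degree_constraints S = {(X, Y, N). X \<subset> Y \<and> Y \<subseteq> S \<and> N \<ge> 1}"

definition dependency_graph ::
    "'a set \<Rightarrow> 'a degree_constraint set \<Rightarrow> 'a pair_pre_digraph" where
  "dependency_graph S C =
     \<lparr>pverts = S, parcs = {(x, y). \<exists>(X, Y, N)\<in>C. X \<noteq> {} \<and> x \<in> X \<and> y \<in> Y - X}\<rparr>"

text \<open>
  Cycles are those of the digraph library; a pair of opposite edges is a cycle of length two.
\<close>
definition cyclic_constraints :: "'a set \<Rightarrow> 'a degree_constraint set \<Rightarrow> bool" where
  "cyclic_constraints S C \<longleftrightarrow> (\<exists>p. pre_digraph.cycle (with_proj (dependency_graph S C)) p)"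

abbreviation acyclic_constraints :: "'a set \<Rightarrow> 'a degree_constraint set \<Rightarrow> bool" where
  "acyclic_constraints S C \<equiv> \<not> cyclic_constraints S C"

text \<open>Only the values on subsets of \<open>S\<close> are constrained, i.e. \<open>h\<close> stands for a function on \<open>Pow S\<close>.\<close>
definition polymatroids :: "'a set \<Rightarrow> 'a degree_constraint set \<Rightarrow> ('a set \<Rightarrow> real) set" where
  "polymatroids S C = {h.
     (\<forall>X\<subseteq>S. 0 \<le> h X) \<and> h {} = 0 \<and> mono_on (Pow S) h \<and>
     (\<forall>X\<subseteq>S. \<forall>Y\<subseteq>S. h (X \<union> Y) + h (X \<inter> Y) \<le> h X + h Y) \<and>
     (\<forall>(X, Y, N)\<in>C. h Y - h X \<le> log 2 (real N))}"

text \<open>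
  The supremum is taken in \<open>ereal\<close>. It is \<open>\<infinity>\<close> if the values \<open>h S\<close> are unbounded; otherwise it
  is a maximum, see \<open>polymat_eq_max\<close>, \<open>polymat_unbounded\<close> and \<open>polymat_max_exists\<close> below.
\<close>
definition polymat :: "'a set \<Rightarrow> 'a degree_constraint set \<Rightarrow> ereal" where
  "polymat S C = (SUP h \<in> polymatroids S C. ereal (2 powr h S))"

definition digraph_constraints ::
    "'a pair_pre_digraph \<Rightarrow> nat \<Rightarrow> nat \<Rightarrow> 'a degree_constraint set" where
  "digraph_constraints P m l = (\<Union>(x, y)\<in>parcs P. {({}, {x, y}, m), ({x}, {x, y}, l)})"

lemma digraph_constraints_wf:
  assumes "pair_digraph P" "1 \<le> m" "1 \<le> l"
  shows "digraph_constraints P m l \<subseteq> degree_constraints (pverts P)"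
proof -
  interpret pair_digraph P by fact
  show ?thesis
    using assms(2,3) no_loops' in_arcsD1 in_arcsD2
    by (fastforce simp: digraph_constraints_def degree_constraints_def)
qed

lemma dependency_graph_digraph_constraints:
  assumes "pair_digraph P"
  shows "dependency_graph (pverts P) (digraph_constraints P m l) = P"
proof -
  interpret pair_digraph P by fact
  let ?D = "digraph_constraints P m l"
  have "(x, y) \<in> parcs (dependency_graph (pverts P) ?D)" if "(x, y) \<in> parcs P" for x y
  proof -
    have "({x}, {x, y}, l) \<in> ?D" "x \<noteq> y"
      using that no_loops' by (auto simp: digraph_constraints_def)
    then show ?thesis
      by (auto simp: dependency_graph_def intro!: bexI[of _ "({x}, {x, y}, l)"])
  qed
  moreover have "parcs (dependency_graph (pverts P) ?D) \<subseteq> parcs P"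
    by (auto simp: dependency_graph_def digraph_constraints_def)
  ultimately have "parcs (dependency_graph (pverts P) ?D) = parcs P"
    by auto
  then show ?thesis
    by (simp add: dependency_graph_def)
qed

lemma polymat_eq_max:
  assumes "h \<in> polymatroids S C" "\<And>g. g \<in> polymatroids S C \<Longrightarrow> g S \<le> h S"
  shows "polymat S C = ereal (2 powr h S)"
  unfolding polymat_def using assms
  by (intro antisym SUP_least SUP_upper) auto

lemma polymat_unbounded:
  assumes "\<not> bdd_above ((\<lambda>h. h S) ` polymatroids S C)"
  shows "polymat S C = \<infinity>"
proof (rule ereal_top)
  fix B :: real
  obtain h where h: "h \<in> polymatroids S C" "log 2 (max B 1) < h S"
    using assms by (auto simp: bdd_above_def not_le)
  then have "max B 1 < 2 powr h S"
    by (subst (asm) log_less_iff) auto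
  then have "ereal B \<le> ereal (2 powr h S)" by simp
  also have "\<dots> \<le> polymat S C"
    unfolding polymat_def using h(1) by (intro SUP_upper)
  finally show "ereal B \<le> polymat S C" .
qed

lemma zero_in_polymatroids:
  assumes "C \<subseteq> degree_constraints S"
  shows "(\<lambda>_. 0) \<in> polymatroids S C"
  using assms by (auto simp: polymatroids_def degree_constraints_def mono_on_def)

lemma polymat_max_exists:
  assumes C: "C \<subseteq> degree_constraints S"
    and bdd: "bdd_above ((\<lambda>h. h S) ` polymatroids S C)"
  shows "\<exists>h\<in>polymatroids S C. \<forall>g\<in>polymatroids S C. g S \<le> h S"
proof -
  obtain B where B: "\<And>h. h \<in> polymatroids S C \<Longrightarrow> h S \<le> B"
    using bdd by (auto simp: bdd_above_def)
  define K :: "('a set \<Rightarrow> real) set"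
    where "K = PiE UNIV (\<lambda>X. if X \<subseteq> S then {0..B} else {0})"
  have "compactin (product_topology (\<lambda>_::'a set. euclidean :: real topology) UNIV) K"
    unfolding K_def by (subst compactin_PiE) auto
  then have K: "compact K"
    by (simp add: euclidean_product_topology)
  have coord: "continuous_on UNIV (\<lambda>h :: 'a set \<Rightarrow> real. h X)" for X
    by (rule continuous_on_product_coordinates)
  have split: "polymatroids S C =
      (\<Inter>X\<in>Pow S. {h. 0 \<le> h X}) \<inter> {h. h {} = 0} \<inter>
      (\<Inter>(X, Y)\<in>{(X, Y). X \<subseteq> Y \<and> Y \<subseteq> S}. {h. h X \<le> h Y}) \<inter>
      (\<Inter>(X, Y)\<in>Pow S \<times> Pow S. {h. h (X \<union> Y) + h (X \<inter> Y) \<le> h X + h Y}) \<inter>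
      (\<Inter>(X, Y, N)\<in>C. {h. h Y - h X \<le> log 2 (real N)})"
    by (auto simp: polymatroids_def mono_on_def; blast)
  have closed: "closed (polymatroids S C)"
    unfolding split
    by (intro closed_Int closed_INT ballI)
      (auto intro!: closed_Collect_le closed_Collect_eq continuous_intros coord
        split: prod.split)
  have "compact (K \<inter> polymatroids S C)"
    using K closed by (rule compact_Int_closed)
  moreover have rest: "(\<lambda>X. if X \<subseteq> S then g X else 0) \<in> K \<inter> polymatroids S C"
    if g: "g \<in> polymatroids S C" for g
  proof -
    have "g X \<le> B" if "X \<subseteq> S" for X
      using B[OF g] g that by (auto simp: polymatroids_def dest!: mono_onD[of _ _ X S])
    then have "(\<lambda>X. if X \<subseteq> S then g X else 0) \<in> K"
      using g by (auto simp: K_def polymatroids_def)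
    moreover have "X \<subseteq> S \<and> Y \<subseteq> S" if "(X, Y, N) \<in> C" for X Y N
      using C that by (auto simp: degree_constraints_def)
    ultimately show ?thesis
      using g by (auto simp: polymatroids_def mono_on_def)
  qed
  moreover have "K \<inter> polymatroids S C \<noteq> {}"
    using rest[OF zero_in_polymatroids[OF C]] by blast
  moreover have "continuous_on (K \<inter> polymatroids S C) (\<lambda>h. h S)"
    using coord by (rule continuous_on_subset) simp
  ultimately obtain h where h: "h \<in> K \<inter> polymatroids S C"
    "\<And>g. g \<in> K \<inter> polymatroids S C \<Longrightarrow> g S \<le> h S"
    using continuous_attains_sup[of "K \<inter> polymatroids S C" "\<lambda>h. h S"] by blast
  have "g S \<le> h S" if "g \<in> polymatroids S C" for g
    using h(2)[OF rest[OF that]] by simp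
  then show ?thesis using h(1) by blast
qed

end

theory Submission
  imports Defs
begin

text \<open>
  Write \<open>a = log m\<close> and \<open>b = log l\<close>. Choose one root in every source component of \<open>P\<close> and order
  the vertices so that every other vertex has an earlier in-neighbour. \<open>DC'\<close> keeps all constraints
  with empty left-hand side, and the constraints of those edges that go forward in the order. By the
  chain rule along the order, a polymatroid \<open>h\<close> for \<open>DC'\<close> yields weights \<open>w\<close> of the same total with
  \<open>w x + w y \<le> a\<close> on all edges and \<open>w y \<le> b\<close> for all non-roots \<open>y\<close>. From \<open>w\<close> one obtains a
  polymatroid for \<open>DC\<close> of at least the same total: the only problem is that a root \<open>r\<close> with
  an in-edge may have \<open>w r > b\<close>. If \<open>a \<le> 2 * b\<close>, the excess \<open>w r - b\<close> is moved to an in-neighbour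
  of \<open>r\<close>. If \<open>2 * b \<le> a\<close>, the weights on the component of \<open>r\<close> are replaced by the function
  that is \<open>a - 2 * b + b * card X\<close> for nonempty \<open>X\<close>. So the two bounds are even equal.
\<close>

section \<open>Polymatroids: closure properties and the chain rule\<close>

lemma polymatroids_antimono: "C \<subseteq> D \<Longrightarrow> polymatroids S D \<subseteq> polymatroids S C"
  by (auto simp: polymatroids_def subset_eq)

lemma polymat_antimono: "C \<subseteq> D \<Longrightarrow> polymat S D \<le> polymat S C"
  unfolding polymat_def by (intro SUP_subset_mono polymatroids_antimono) auto

lemma polymatroidsI:
  assumes "h {} = 0" and "\<And>X Y. X \<subseteq> Y \<Longrightarrow> Y \<subseteq> S \<Longrightarrow> h X \<le> h Y"
    and "\<And>X Y. X \<subseteq> S \<Longrightarrow> Y \<subseteq> S \<Longrightarrow> h (X \<union> Y) + h (X \<inter> Y) \<le> h X + h Y"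
  shows "h \<in> polymatroids S {}"
  using assms assms(2)[of "{}"] by (auto simp: polymatroids_def mono_on_def)

lemma polymatroidsD:
  assumes "h \<in> polymatroids S C"
  shows "h {} = 0" and "X \<subseteq> Y \<Longrightarrow> Y \<subseteq> S \<Longrightarrow> h X \<le> h Y"
    and "X \<subseteq> S \<Longrightarrow> Y \<subseteq> S \<Longrightarrow> h (X \<union> Y) + h (X \<inter> Y) \<le> h X + h Y"
    and "(X, Y, N) \<in> C \<Longrightarrow> h Y - h X \<le> log 2 (real N)"
  using assms by (auto simp: polymatroids_def mono_on_def)

text \<open>Diminishing returns; this compares the increments of the chain rule with the increments
  in the edge constraints.\<close>

lemma polymatroids_insert_diff_le:
  assumes h: "h \<in> polymatroids S C" and "A \<subseteq> B" "insert y B \<subseteq> S" "y \<notin> B"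
  shows "h (insert y B) - h B \<le> h (insert y A) - h A"
proof -
  have "insert y A \<union> B = insert y B" "insert y A \<inter> B = A" "insert y A \<subseteq> S" "B \<subseteq> S"
    using assms(2-4) by auto
  moreover have "h (insert y A \<union> B) + h (insert y A \<inter> B) \<le> h (insert y A) + h B"
    using calculation(3,4) by (rule polymatroidsD(3)[OF h])
  ultimately show ?thesis by simp
qed

lemma polymatroids_add:
  assumes f: "f \<in> polymatroids S {}" and g: "g \<in> polymatroids S {}"
  shows "(\<lambda>X. f X + g X) \<in> polymatroids S {}"
proof (rule polymatroidsI)
  fix X Y assume "X \<subseteq> S" "Y \<subseteq> S"
  then show "f (X \<union> Y) + g (X \<union> Y) + (f (X \<inter> Y) + g (X \<inter> Y)) \<le> f X + g X + (f Y + g Y)"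
    using polymatroidsD(3)[OF f] polymatroidsD(3)[OF g] by (smt (verit))
qed (use polymatroidsD[OF f] polymatroidsD[OF g] in \<open>auto intro: add_mono\<close>)

lemma polymatroids_cmult:
  assumes f: "f \<in> polymatroids S {}" and c: "0 \<le> c"
  shows "(\<lambda>X. c * f X) \<in> polymatroids S {}"
  using polymatroidsD[OF f] c
  by (intro polymatroidsI) (auto intro: mult_left_mono simp flip: distrib_left)

lemma polymatroids_sum:
  assumes "finite S" "\<And>x. x \<in> S \<Longrightarrow> 0 \<le> w x"
  shows "sum w \<in> polymatroids S {}"
proof (rule polymatroidsI)
  fix X Y assume "X \<subseteq> S" "Y \<subseteq> S"
  then show "sum w (X \<union> Y) + sum w (X \<inter> Y) \<le> sum w X + sum w Y"
    using assms(1) by (simp add: sum.union_inter finite_subset)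
next
  fix X Y assume "X \<subseteq> Y" "Y \<subseteq> S"
  then show "sum w X \<le> sum w Y"
    using assms by (intro sum_mono2) (auto intro: finite_subset)
qed simp

text \<open>A coverage function: hitting commutes with unions, and whatever
  \<open>X \<inter> Y\<close> hits is hit by both \<open>X\<close> and \<open>Y\<close>.\<close>

lemma polymatroids_card_hitting:
  assumes "finite R"
  shows "(\<lambda>X. real (card {r\<in>R. X \<inter> A r \<noteq> {}})) \<in> polymatroids S {}"
proof -
  let ?T = "\<lambda>X. {r\<in>R. X \<inter> A r \<noteq> {}}"
  have fin: "finite (?T X)" for X using assms by simp
  have "card (?T (X \<union> Y)) + card (?T (X \<inter> Y)) \<le> card (?T X) + card (?T Y)" for X Y
  proof -
    have "?T (X \<union> Y) = ?T X \<union> ?T Y" by auto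
    moreover have "card (?T (X \<inter> Y)) \<le> card (?T X \<inter> ?T Y)"
      using fin by (intro card_mono) auto
    ultimately show ?thesis
      using card_Un_Int[OF fin fin, of X Y] by simp
  qed
  then have "real (card (?T (X \<union> Y))) + real (card (?T (X \<inter> Y)))
      \<le> real (card (?T X)) + real (card (?T Y))" for X Y
    by (simp only: of_nat_add[symmetric] of_nat_le_iff)
  moreover have "card (?T X) \<le> card (?T Y)" if "X \<subseteq> Y" for X Y
    using that fin by (intro card_mono) auto
  ultimately show ?thesis by (intro polymatroidsI) auto
qed

lemma polymatroids_digraph_constraintsI:
  assumes "h \<in> polymatroids S {}"
    and "\<And>x y. (x, y) \<in> parcs P \<Longrightarrow> h {x, y} \<le> log 2 m \<and> h {x, y} - h {x} \<le> log 2 l"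
  shows "h \<in> polymatroids S (digraph_constraints P m l)"
  using assms by (auto simp: polymatroids_def digraph_constraints_def)

text \<open>Telescoping: the element of largest rank is added last, which leaves the initial
  segments of the others unchanged.\<close>

lemma sum_chain_rule:
  fixes h :: "'a set \<Rightarrow> real" and \<rho> :: "'a \<Rightarrow> nat"
  assumes "finite S" "inj_on \<rho> S"
  shows "(\<Sum>x\<in>S. h {y\<in>S. \<rho> y \<le> \<rho> x} - h {y\<in>S. \<rho> y < \<rho> x}) = h S - h {}"
  using assms
proof (induction S rule: finite_ranking_induct[where f = \<rho>])
  case (insert x S)
  show ?case
  proof (cases "x \<in> S")
    case True
    then show ?thesis using insert by (simp add: insert_absorb)
  next
    case False
    have less: "\<rho> y < \<rho> x" if "y \<in> S" for y
    proof -
      have "\<rho> y \<noteq> \<rho> x"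
        using insert.prems that False by (auto simp: inj_on_def)
      then show ?thesis using insert.hyps(2)[OF that] by simp
    qed
    have "{y \<in> insert x S. \<rho> y \<le> \<rho> z} = {y \<in> S. \<rho> y \<le> \<rho> z}"
      "{y \<in> insert x S. \<rho> y < \<rho> z} = {y \<in> S. \<rho> y < \<rho> z}" if "z \<in> S" for z
      using less[OF that] by auto
    moreover have "{y \<in> insert x S. \<rho> y \<le> \<rho> x} = insert x S"
      "{y \<in> insert x S. \<rho> y < \<rho> x} = S"
      using less by (auto intro: less_imp_le)
    ultimately show ?thesis
      using insert False by simp
  qed
qed simp

section \<open>Roots of the source components and the ranking\<close>

text \<open>Together, \<open>reach\<close> and \<open>antichain\<close> say that \<open>R\<close>
  has exactly one vertex in each source strongly connected component, without mentioning
  components.\<close>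

locale root_system =
  fixes V :: "'a set" and E :: "('a \<times> 'a) set" and R :: "'a set"
  assumes finite_V: "finite V"
    and E_subset: "E \<subseteq> V \<times> V"
    and no_loop: "(x, x) \<notin> E"
    and R_subset: "R \<subseteq> V"
    and reach: "v \<in> V \<Longrightarrow> \<exists>r\<in>R. (r, v) \<in> E\<^sup>*"
    and antichain: "r \<in> R \<Longrightarrow> s \<in> R \<Longrightarrow> (r, s) \<in> E\<^sup>* \<Longrightarrow> r = s"

lemma ex_root_system:
  assumes "finite V" "E \<subseteq> V \<times> V" "\<And>x. (x, x) \<notin> E"
  shows "\<exists>R. root_system V E R"
proof -
  let ?Q = "\<lambda>R. R \<subseteq> V \<and> (\<forall>v\<in>V. \<exists>r\<in>R. (r, v) \<in> E\<^sup>*)"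
  have "?Q V" by auto
  then obtain R where R: "?Q R" and min: "\<And>R'. ?Q R' \<Longrightarrow> card R \<le> card R'"
    using ex_has_least_nat[of ?Q V card] by blast
  have "r = s" if rs: "r \<in> R" "s \<in> R" "(r, s) \<in> E\<^sup>*" for r s
  proof (rule ccontr)
    assume "r \<noteq> s"
    \<comment> \<open>Whatever \<open>s\<close> reaches is also reached from \<open>r\<close>, so a
      smallest \<open>R\<close> would not contain \<open>s\<close>.\<close>
    with R rs have "?Q (R - {s})"
      by (metis Diff_iff rtrancl_trans singletonD subset_iff)
    then have "card R \<le> card (R - {s})" by (rule min)
    moreover have "card (R - {s}) < card R"
      using rs R assms(1) by (meson card_Diff1_less finite_subset)
    ultimately show False by simp
  qed
  then have "root_system V E R"
    using assms R by unfold_locales auto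
  then show ?thesis ..
qed

context root_system
begin

text \<open>Rank by distance from \<open>R\<close> and break ties by an injective numbering; the
  last step of a shortest path to a non-root comes from a closer vertex.\<close>

lemma ex_ranking:
  "\<exists>\<rho> :: 'a \<Rightarrow> nat. inj_on \<rho> V \<and> (\<forall>y\<in>V - R. \<exists>x. (x, y) \<in> E \<and> \<rho> x < \<rho> y)"
proof -
  define d where "d y = (LEAST n. \<exists>r\<in>R. (r, y) \<in> E ^^ n)" for y
  obtain f :: "'a \<Rightarrow> nat" and n where f: "f ` V = {i. i < n}" "inj_on f V"
    using finite_imp_inj_to_nat_seg[OF finite_V] by blast
  \<comment> \<open>As \<open>f x < n\<close> on \<open>V\<close>, this orders the pairs
    \<open>(d x, f x)\<close> lexicographically.\<close>
  define \<rho> where "\<rho> x = d x * n + f x" for x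
  have fn: "f x < n" if "x \<in> V" for x using f that by auto
  have less: "\<rho> x < \<rho> y" if "d x < d y" "x \<in> V" for x y
  proof -
    have "\<rho> x < d x * n + n" using fn that by (simp add: \<rho>_def)
    also have "\<dots> = Suc (d x) * n" by simp
    also have "\<dots> \<le> d y * n" using that by (intro mult_le_mono1) simp
    finally show ?thesis by (simp add: \<rho>_def)
  qed
  have "inj_on \<rho> V"
  proof (rule inj_onI)
    fix x y assume xy: "x \<in> V" "y \<in> V" "\<rho> x = \<rho> y"
    with less[of x y] less[of y x] have "d x = d y" by force
    with xy f(2) show "x = y" by (auto simp: \<rho>_def inj_on_def)
  qed
  moreover have "\<exists>x. (x, y) \<in> E \<and> \<rho> x < \<rho> y" if y: "y \<in> V - R" for y
  proof -
    have "\<exists>k. \<exists>r\<in>R. (r, y) \<in> E ^^ k"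
      using reach[of y] y by (auto simp: rtrancl_power)
    then have "\<exists>r\<in>R. (r, y) \<in> E ^^ d y"
      unfolding d_def by (rule LeastI_ex)
    then obtain r where r: "r \<in> R" "(r, y) \<in> E ^^ d y" by blast
    with y obtain k where k: "d y = Suc k"
      by (cases "d y") auto
    with r obtain x where x: "(r, x) \<in> E ^^ k" "(x, y) \<in> E" by auto
    have "d x \<le> k" unfolding d_def using r x by (intro Least_le) blast
    then show ?thesis using less[of x y] k x E_subset by auto
  qed
  ultimately show ?thesis by blast
qed

section \<open>Basins of the roots\<close>

text \<open>Roots whose source component contains a cycle. Among the heads of edges, only these need
  not have an in-neighbour of smaller rank.\<close>

definition cyclic_roots :: "'a set" where
  "cyclic_roots = R \<inter> Range E"

text \<open>For a root this is its source component, because \<open>root_reaches_basin\<close>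
  supplies the paths back.\<close>

definition basin :: "'a \<Rightarrow> 'a set" where
  "basin r = {x. (x, r) \<in> E\<^sup>*}"

lemma finite_cyclic_roots: "finite cyclic_roots"
  using finite_V R_subset by (auto simp: cyclic_roots_def intro: finite_subset)

lemma self_in_basin: "r \<in> basin r"
  by (simp add: basin_def)

lemma basin_closed: "(x, y) \<in> E \<Longrightarrow> y \<in> basin r \<Longrightarrow> x \<in> basin r"
  by (auto simp: basin_def)

lemma basin_subset: "r \<in> R \<Longrightarrow> basin r \<subseteq> V"
  using E_subset R_subset by (auto simp: basin_def elim: converse_rtranclE)

text \<open>Some root reaches \<open>x\<close> and hence \<open>r\<close>; by
  \<open>antichain\<close> it is \<open>r\<close> itself.\<close>

lemma root_reaches_basin:
  assumes "r \<in> R" "x \<in> basin r" shows "(r, x) \<in> E\<^sup>*"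
  using assms reach[of x] antichain basin_subset
  by (metis basin_def mem_Collect_eq rtrancl_trans subsetD)

lemma basin_unique:
  assumes "r \<in> R" "s \<in> R" "x \<in> basin r" "x \<in> basin s" shows "r = s"
proof -
  have "(r, x) \<in> E\<^sup>*" "(x, s) \<in> E\<^sup>*"
    using root_reaches_basin assms by (auto simp: basin_def)
  then show ?thesis using antichain assms(1,2) by (meson rtrancl_trans)
qed

lemma basin_in_Range:
  assumes "r \<in> cyclic_roots" "x \<in> basin r" shows "x \<in> Range E"
proof (cases "x = r")
  case False
  then show ?thesis
    using root_reaches_basin[of r x] assms by (auto simp: cyclic_roots_def elim: rtranclE)
qed (use assms in \<open>simp add: cyclic_roots_def\<close>)

section \<open>From weights to polymatroids for all constraints\<close>

text \<open>Each cyclic basin costs \<open>a - 2 * b\<close> once, as soon as it is hit, plus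
  \<open>b\<close> per vertex; \<open>2 * b \<le> a\<close> makes this charge nonnegative. Outside
  these basins the weights stay.\<close>

lemma ex_polymatroid_of_weights_small:
  fixes a b :: real and w :: "'a \<Rightarrow> real"
  assumes b: "0 \<le> b" "2 * b \<le> a"
    and nonneg: "\<And>x. x \<in> V \<Longrightarrow> 0 \<le> w x"
    and edge: "\<And>x y. (x, y) \<in> E \<Longrightarrow> w x + w y \<le> a"
    and nonroot: "\<And>y. y \<in> V - R \<Longrightarrow> w y \<le> b"
  shows "\<exists>h\<in>polymatroids V {}. sum w V \<le> h V \<and>
    (\<forall>(x, y)\<in>E. h {x, y} \<le> a \<and> h {x, y} - h {x} \<le> b)"
proof -
  define D where "D = (\<Union>r\<in>cyclic_roots. basin r)"
  define u where "u x = (if x \<in> D then b else w x)" for x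
  define T where "T X = {r\<in>cyclic_roots. X \<inter> basin r \<noteq> {}}" for X
  define h where "h X = (a - 2 * b) * real (card (T X)) + sum u X" for X
  have D_subset: "D \<subseteq> V"
    using basin_subset by (auto simp: D_def cyclic_roots_def)
  have "h \<in> polymatroids V {}"
    unfolding h_def T_def using b nonneg
    by (intro polymatroids_add polymatroids_cmult polymatroids_card_hitting polymatroids_sum
          finite_cyclic_roots finite_V) (auto simp: u_def)
  moreover have "sum w V \<le> h V"
  proof -
    \<comment> \<open>The root and an in-neighbour weigh at most
      \<open>a = (a - 2 * b) + b + b\<close> together, and every other vertex of the basin at most
      \<open>b\<close>.\<close>
    have basin_le: "sum w (basin r) \<le> (a - 2 * b) + sum u (basin r)" if r: "r \<in> cyclic_roots" for r
    proof -
      obtain x where x: "(x, r) \<in> E" using r by (auto simp: cyclic_roots_def)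
      then have xb: "x \<in> basin r" "x \<noteq> r"
        using basin_closed self_in_basin no_loop by auto
      have fin: "finite (basin r)"
        using r basin_subset finite_V by (auto simp: cyclic_roots_def intro: finite_subset)
      have u: "u y = b" if "y \<in> basin r" for y
        using that r by (auto simp: u_def D_def)
      have "w y \<le> u y" if y: "y \<in> basin r - {x, r}" for y
      proof -
        have "y \<notin> R"
          using y r basin_unique[of y r y] self_in_basin by (auto simp: cyclic_roots_def)
        then show ?thesis
          using y r basin_subset nonroot[of y] u[of y] by (auto simp: cyclic_roots_def)
      qed
      then have "sum w (basin r - {x, r}) \<le> sum u (basin r - {x, r})"
        by (rule sum_mono)
      moreover have "sum f (basin r) = f x + f r + sum f (basin r - {x, r})" for f :: "'a \<Rightarrow> real"
        using fin xb self_in_basin[of r] sum.subset_diff[of "{x, r}" "basin r" f] by auto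
      ultimately show ?thesis
        using edge[OF x] u[OF xb(1)] u[OF self_in_basin] by (simp add: algebra_simps)
    qed
    have sum_D: "sum f D = (\<Sum>r\<in>cyclic_roots. sum f (basin r))" for f :: "'a \<Rightarrow> real"
      unfolding D_def
    proof (rule sum.UNION_disjoint)
      show "\<forall>r\<in>cyclic_roots. finite (basin r)"
        using basin_subset finite_V by (auto simp: cyclic_roots_def intro: finite_subset)
      show "\<forall>r\<in>cyclic_roots. \<forall>s\<in>cyclic_roots. r \<noteq> s \<longrightarrow> basin r \<inter> basin s = {}"
        using basin_unique by (auto simp: cyclic_roots_def)
    qed (rule finite_cyclic_roots)
    have "T V = cyclic_roots"
      using self_in_basin R_subset by (auto simp: T_def cyclic_roots_def)
    moreover have "sum w D \<le> real (card cyclic_roots) * (a - 2 * b) + sum u D"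
      unfolding sum_D using sum_mono[of cyclic_roots, OF basin_le] by (simp add: sum.distrib)
    moreover have "sum w (V - D) = sum u (V - D)"
      by (simp add: u_def)
    moreover have "sum f V = sum f (V - D) + sum f D" for f :: "'a \<Rightarrow> real"
      using D_subset finite_V by (rule sum.subset_diff)
    ultimately show ?thesis by (simp add: h_def mult.commute)
  qed
  moreover have "h {x, y} \<le> a \<and> h {x, y} - h {x} \<le> b" if xy: "(x, y) \<in> E" for x y
  proof -
    have "x \<noteq> y" "y \<in> V" using xy no_loop E_subset by auto
    \<comment> \<open>A basin contains the in-neighbours of its members, so \<open>y\<close> hits no
      basin that \<open>x\<close> misses and adds only \<open>u y\<close>.\<close>
    have "T {x, y} = T {x}"
      using basin_closed[OF xy] by (auto simp: T_def)
    then have h: "h {x, y} = h {x} + u y"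
      using \<open>x \<noteq> y\<close> by (simp add: h_def)
    \<comment> \<open>Having an in-edge, \<open>y\<close> is a cyclic root if it is a root at all,
      and then lies in its own basin.\<close>
    have y: "y \<in> D \<or> y \<notin> R"
      using xy self_in_basin by (auto simp: D_def cyclic_roots_def)
    then have uy: "u y \<le> b"
      using nonroot[of y] \<open>y \<in> V\<close> by (auto simp: u_def)
    \<comment> \<open>Either exactly one basin is hit and the value is
      \<open>(a - 2 * b) + b + u y\<close>, or none is hit and the old edge bound applies.\<close>
    have "h {x, y} \<le> a"
    proof (cases "x \<in> D")
      case True
      then obtain r where "r \<in> cyclic_roots" "x \<in> basin r" by (auto simp: D_def)
      then have "T {x} = {r}"
        using basin_unique[of _ r x] by (auto simp: T_def cyclic_roots_def)
      then show ?thesis using uy True by (simp add: h) (simp add: h_def u_def)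
    next
      case False
      then have "T {x} = {}" "y \<notin> D"
        using basin_closed[OF xy] by (auto simp: T_def D_def)
      then show ?thesis using False edge[OF xy] by (simp add: h) (simp add: h_def u_def)
    qed
    then show ?thesis using h uy by simp
  qed
  ultimately show ?thesis by blast
qed

text \<open>The function stays modular. The in-neighbour \<open>p r\<close> can take the excess of
  \<open>r\<close>: the edge bound leaves it with at most \<open>a - b \<le> b\<close>.\<close>

lemma ex_polymatroid_of_weights_large:
  fixes a b :: real and w :: "'a \<Rightarrow> real"
  assumes b: "b \<le> a" "a \<le> 2 * b"
    and nonneg: "\<And>x. x \<in> V \<Longrightarrow> 0 \<le> w x"
    and edge: "\<And>x y. (x, y) \<in> E \<Longrightarrow> w x + w y \<le> a"
    and nonroot: "\<And>y. y \<in> V - R \<Longrightarrow> w y \<le> b"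
  shows "\<exists>h\<in>polymatroids V {}. sum w V \<le> h V \<and>
    (\<forall>(x, y)\<in>E. h {x, y} \<le> a \<and> h {x, y} - h {x} \<le> b)"
proof -
  have "\<forall>r\<in>cyclic_roots. \<exists>x. (x, r) \<in> E"
    by (auto simp: cyclic_roots_def)
  then obtain p where p: "\<And>r. r \<in> cyclic_roots \<Longrightarrow> (p r, r) \<in> E"
    by metis
  define e where "e x = (if x \<in> cyclic_roots then max 0 (w x - b) else 0)" for x
  \<comment> \<open>The excess \<open>e r\<close> leaves \<open>r\<close> and arrives at
    \<open>p r\<close>.\<close>
  define w' where "w' x = w x - e x + (\<Sum>r | r \<in> cyclic_roots \<and> p r = x. e r)" for x
  have p_basin: "p r \<in> basin r" if "r \<in> cyclic_roots" for r
    using basin_closed p self_in_basin that by blast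
  have p_not_root: "p r \<notin> R" if r: "r \<in> cyclic_roots" for r
  proof
    assume "p r \<in> R"
    then have "p r = r"
      using basin_unique[of "p r" r "p r"] self_in_basin p_basin r by (auto simp: cyclic_roots_def)
    then show False using p[OF r] no_loop by simp
  qed
  \<comment> \<open>Basins are disjoint, so \<open>p\<close> is injective on cyclic roots and
    \<open>p r\<close> receives only once; not being a root, it gives nothing away.\<close>
  have w'_p: "w' (p r) = w (p r) + e r" if r: "r \<in> cyclic_roots" for r
  proof -
    have "s = r" if "s \<in> cyclic_roots" "p s = p r" for s
      using basin_unique[of s r "p r"] p_basin r that by (metis IntE cyclic_roots_def)
    then have "{s. s \<in> cyclic_roots \<and> p s = p r} = {r}" using r by auto
    moreover have "e (p r) = 0"
      using p_not_root[OF r] by (simp add: e_def cyclic_roots_def)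
    ultimately show ?thesis by (simp add: w'_def)
  qed
  have w'_other: "w' x = w x - e x" if "x \<notin> p ` cyclic_roots" for x
  proof -
    have "{r. r \<in> cyclic_roots \<and> p r = x} = {}" using that by auto
    then show ?thesis unfolding w'_def by (metis add.right_neutral sum.empty)
  qed
  have e_nonneg: "0 \<le> e x" for x by (simp add: e_def)
  have b_nonneg: "0 \<le> b" using b by simp
  have w'_nonneg: "0 \<le> w' x" if "x \<in> V" for x
  proof (cases "x \<in> p ` cyclic_roots")
    case True
    then show ?thesis using w'_p nonneg[OF that] e_nonneg by auto
  next
    case False
    then show ?thesis using w'_other[of x] nonneg[OF that] b_nonneg by (auto simp: e_def)
  qed
  \<comment> \<open>If \<open>e r > 0\<close> then \<open>w r = b + e r\<close>; insert this into
    the edge bound for \<open>(p r, r)\<close>.\<close>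
  have excess: "w (p r) + e r \<le> a - b" if "r \<in> cyclic_roots" "e r > 0" for r
    using edge[OF p] that by (fastforce simp: e_def split: if_splits)
  have w'_le_b: "w' y \<le> b" if "y \<in> Range E" for y
  proof -
    have y: "y \<in> V" using that E_subset by auto
    show ?thesis
    proof (cases "y \<in> p ` cyclic_roots")
      case True
      then obtain r where r: "r \<in> cyclic_roots" "y = p r" by auto
      show ?thesis
        using w'_p[OF r(1)] excess[OF r(1)] e_nonneg[of r] b nonroot[of y] p_not_root[OF r(1)] r y
        by (cases "e r = 0") auto
    next
      case False
      then show ?thesis
        using w'_other[of y] nonroot[of y] y that
        by (cases "y \<in> R") (auto simp: e_def cyclic_roots_def)
    qed
  qed
  have w'_le: "w' x \<le> w x \<or> (\<exists>r\<in>cyclic_roots. x = p r \<and> w' x \<le> a - b)" for x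
  proof (cases "x \<in> p ` cyclic_roots")
    case True
    then obtain r where r: "r \<in> cyclic_roots" "x = p r" by auto
    show ?thesis
      using w'_p[OF r(1)] excess[OF r(1)] e_nonneg[of r] r by (cases "e r = 0") auto
  next
    case False
    then show ?thesis using w'_other[of x] e_nonneg[of x] by simp
  qed
  have w'_edge: "w' x + w' y \<le> a" if xy: "(x, y) \<in> E" for x y
  proof -
    have y: "w' y \<le> b" using xy w'_le_b by blast
    \<comment> \<open>If one end received a positive excess, it is at most \<open>a - b\<close> and
      the other end must be at most \<open>b\<close>. For \<open>y = p r\<close> this holds because
      \<open>x\<close> is in the basin of \<open>r\<close> and so has an in-edge itself.\<close>
    consider "w' x \<le> a - b" | r where "r \<in> cyclic_roots" "y = p r" "w' y \<le> a - b"
      | "w' x \<le> w x" "w' y \<le> w y"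
      using w'_le[of x] w'_le[of y] by blast
    then show ?thesis
    proof cases
      case 2
      then have "x \<in> basin r" using basin_closed[OF xy] p_basin by simp
      then have "w' x \<le> b" using 2 basin_in_Range w'_le_b by blast
      then show ?thesis using 2 by simp
    qed (use y edge[OF xy] in auto)
  qed
  have "p ` cyclic_roots \<subseteq> V"
    using p E_subset by auto
  \<comment> \<open>All that is moved arrives inside \<open>V\<close>, so the total is kept.\<close>
  then have "(\<Sum>x\<in>V. \<Sum>r | r \<in> cyclic_roots \<and> p r = x. e r) = sum e cyclic_roots"
    using finite_V finite_cyclic_roots by (intro sum.group)
  moreover have "sum e V = sum e cyclic_roots"
    using finite_V R_subset by (intro sum.mono_neutral_right) (auto simp: e_def cyclic_roots_def)
  ultimately have "sum w' V = sum w V"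
    by (simp add: w'_def sum.distrib sum_subtractf)
  moreover have "sum w' \<in> polymatroids V {}"
    using finite_V w'_nonneg by (rule polymatroids_sum)
  moreover have "sum w' {x, y} \<le> a \<and> sum w' {x, y} - sum w' {x} \<le> b" if "(x, y) \<in> E" for x y
    using w'_edge[OF that] w'_le_b[of y] that no_loop by (cases "x = y") auto
  ultimately show ?thesis by (intro bexI[of _ "sum w'"]) auto
qed

end

section \<open>The acyclic subset and its bound\<close>

text \<open>Constraints with empty left-hand side give no edge of the dependency graph, so they are
  kept for all arcs.\<close>

definition forward_constraints ::
    "'a pair_pre_digraph \<Rightarrow> ('a \<Rightarrow> nat) \<Rightarrow> nat \<Rightarrow> nat \<Rightarrow> 'a degree_constraint set" where
  "forward_constraints P \<rho> m l =
     (\<Union>(x, y)\<in>parcs P. {({}, {x, y}, m)}) \<union>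
     (\<Union>(x, y)\<in>{(x, y)\<in>parcs P. \<rho> x < \<rho> y}. {({x}, {x, y}, l)})"

lemma forward_constraints_subset: "forward_constraints P \<rho> m l \<subseteq> digraph_constraints P m l"
  by (auto simp: forward_constraints_def digraph_constraints_def)

text \<open>The rank increases strictly along every dependency edge, so a cycle at \<open>u\<close>
  would give \<open>\<rho> u < \<rho> u\<close>.\<close>

lemma acyclic_forward_constraints: "acyclic_constraints S (forward_constraints P \<rho> m l)"
proof
  let ?G = "dependency_graph S (forward_constraints P \<rho> m l)"
  assume "cyclic_constraints S (forward_constraints P \<rho> m l)"
  then obtain u p where p: "pre_digraph.awalk (with_proj ?G) u p u" "p \<noteq> []"
    by (auto simp: cyclic_constraints_def pre_digraph.cycle_def)
  have less: "\<rho> x < \<rho> y" if "(x, y) \<in> parcs ?G" for x y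
    using that by (auto simp: dependency_graph_def forward_constraints_def)
  have walk: "\<rho> u \<le> \<rho> v \<and> (p \<noteq> [] \<longrightarrow> \<rho> u < \<rho> v)"
    if "pre_digraph.cas (with_proj ?G) u p v" "set p \<subseteq> parcs ?G" for u v p
    using that
  proof (induction p arbitrary: u)
    case Nil
    then show ?case by (simp add: pre_digraph.cas.simps)
  next
    case (Cons e p)
    then show ?case
      using less[of "fst e" "snd e"] by (fastforce simp: pre_digraph.cas.simps)
  qed
  show False
    using p walk[of u p u] by (auto simp: pre_digraph.awalk_def)
qed

text \<open>The weight of \<open>x\<close> is its increment over all vertices of smaller rank. By
  diminishing returns it is at most the increment over \<open>{}\<close> or over one earlier
  neighbour.\<close>

lemma ex_weights_of_forward_polymatroid:
  assumes P: "pair_digraph P" and inj: "inj_on \<rho> (pverts P)"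
    and h: "h \<in> polymatroids (pverts P) (forward_constraints P \<rho> m l)"
  shows "\<exists>w. sum w (pverts P) = h (pverts P) \<and> (\<forall>x\<in>pverts P. 0 \<le> w x) \<and>
    (\<forall>(x, y)\<in>parcs P. w x + w y \<le> log 2 m \<and> (\<rho> x < \<rho> y \<longrightarrow> w y \<le> log 2 l))"
proof -
  interpret pair_digraph P by fact
  let ?V = "pverts P"
  define B where "B x = {y\<in>?V. \<rho> y < \<rho> x}" for x
  define w where "w x = h (insert x (B x)) - h (B x)" for x
  have h_empty: "h {} = 0" and mono: "\<And>X Y. X \<subseteq> Y \<Longrightarrow> Y \<subseteq> ?V \<Longrightarrow> h X \<le> h Y"
    using polymatroidsD[OF h] by auto
  have w_le: "w x \<le> h (insert x A) - h A" if "A \<subseteq> B x" "x \<in> ?V" for x A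
    unfolding w_def using that by (intro polymatroids_insert_diff_le[OF h]) (auto simp: B_def)
  have pair: "w x + w y \<le> h {x, y} \<and> w y \<le> h {x, y} - h {x}"
    if "x \<in> ?V" "y \<in> ?V" "\<rho> x < \<rho> y" for x y
    using w_le[of "{}" x] w_le[of "{x}" y] that h_empty by (auto simp: B_def insert_commute)
  have "{y\<in>?V. \<rho> y \<le> \<rho> x} = insert x (B x)" if "x \<in> ?V" for x
    using that inj by (auto simp: B_def inj_on_def order_le_less)
  then have "sum w ?V = h ?V"
    using sum_chain_rule[of ?V \<rho> h] inj h_empty by (simp add: w_def B_def)
  moreover have "0 \<le> w x" if "x \<in> ?V" for x
    using mono[of "B x" "insert x (B x)"] that by (auto simp: w_def B_def)
  moreover have "w x + w y \<le> log 2 m \<and> (\<rho> x < \<rho> y \<longrightarrow> w y \<le> log 2 l)"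
    if xy: "(x, y) \<in> parcs P" for x y
  proof -
    have V: "x \<in> ?V" "y \<in> ?V" "x \<noteq> y"
      using xy no_loops' in_arcsD1 in_arcsD2 by auto
    then have "\<rho> x \<noteq> \<rho> y" using inj by (auto simp: inj_on_def)
    then have "w x + w y \<le> h {x, y}"
      using pair[of x y] pair[of y x] V by (cases "\<rho> x < \<rho> y") (auto simp: insert_commute)
    moreover have "({}, {x, y}, m) \<in> forward_constraints P \<rho> m l"
      using xy by (auto simp: forward_constraints_def)
    then have "h {x, y} \<le> log 2 m"
      using polymatroidsD(4)[OF h] h_empty by fastforce
    moreover have "w y \<le> log 2 l" if "\<rho> x < \<rho> y"
    proof -
      have "({x}, {x, y}, l) \<in> forward_constraints P \<rho> m l"
        using xy that by (auto simp: forward_constraints_def)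
      then have "h {x, y} - h {x} \<le> log 2 l"
        by (rule polymatroidsD(4)[OF h])
      then show ?thesis using pair[OF V(1,2) that] by simp
    qed
    ultimately show ?thesis by simp
  qed
  ultimately show ?thesis by (intro exI[of _ w]) auto
qed

text \<open>Via its weights, every polymatroid for the forward constraints is matched by one for all
  constraints with at least the same value on the whole vertex set.\<close>

lemma polymat_forward_constraints_le:
  assumes P: "pair_digraph P" and R: "root_system (pverts P) (parcs P) R"
    and inj: "inj_on \<rho> (pverts P)"
    and rank: "\<And>y. y \<in> pverts P - R \<Longrightarrow> \<exists>x. (x, y) \<in> parcs P \<and> \<rho> x < \<rho> y"
    and ml: "1 \<le> l" "l \<le> m"
  shows "polymat (pverts P) (forward_constraints P \<rho> m l)
    \<le> polymat (pverts P) (digraph_constraints P m l)"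
  unfolding polymat_def
proof (rule SUP_mono)
  interpret root_system "pverts P" "parcs P" R by fact
  let ?V = "pverts P"
  fix g assume "g \<in> polymatroids ?V (forward_constraints P \<rho> m l)"
  from ex_weights_of_forward_polymatroid[OF P inj this]
  obtain w where w: "sum w ?V = g ?V" "\<And>x. x \<in> ?V \<Longrightarrow> 0 \<le> w x"
    "\<And>x y. (x, y) \<in> parcs P \<Longrightarrow> w x + w y \<le> log 2 m"
    and fwd: "\<And>x y. (x, y) \<in> parcs P \<Longrightarrow> \<rho> x < \<rho> y \<Longrightarrow> w y \<le> log 2 l"
    by blast
  \<comment> \<open>The edge from the earlier in-neighbour is forward, so its constraint was
    kept.\<close>
  have nonroot: "w y \<le> log 2 l" if "y \<in> ?V - R" for y
    using rank[OF that] fwd by blast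
  have "0 \<le> log 2 (real l)" "log 2 (real l) \<le> log 2 (real m)"
    using ml by auto
  then have "\<exists>h\<in>polymatroids ?V {}. sum w ?V \<le> h ?V \<and>
    (\<forall>(x, y)\<in>parcs P. h {x, y} \<le> log 2 m \<and> h {x, y} - h {x} \<le> log 2 l)"
    using ex_polymatroid_of_weights_small[OF _ _ w(2,3) nonroot]
      ex_polymatroid_of_weights_large[OF _ _ w(2,3) nonroot]
    by (cases "2 * log 2 l \<le> log 2 m") simp_all
  then obtain h where h: "h \<in> polymatroids ?V {}" "sum w ?V \<le> h ?V"
    "\<forall>(x, y)\<in>parcs P. h {x, y} \<le> log 2 m \<and> h {x, y} - h {x} \<le> log 2 l"
    by blast
  then have "h \<in> polymatroids ?V (digraph_constraints P m l)"
    by (intro polymatroids_digraph_constraintsI) auto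
  moreover have "ereal (2 powr g ?V) \<le> ereal (2 powr h ?V)"
    using h(2) w(1) by simp
  ultimately show "\<exists>h\<in>polymatroids ?V (digraph_constraints P m l).
      ereal (2 powr g ?V) \<le> ereal (2 powr h ?V)" by blast
qed

theorem lemma4p1:
  fixes P :: "'a pair_pre_digraph"
  assumes "pair_digraph P"
    and "Digraph_Component.connected (with_proj P)"
  shows "\<exists>c C :: real. 0 < c \<and> 0 < C \<and>
    (\<forall>m l :: nat. 1 \<le> m \<longrightarrow> 1 \<le> l \<longrightarrow> l \<le> m \<longrightarrow>
      cyclic_constraints (pverts P) (digraph_constraints P m l) \<longrightarrow>
      (\<exists>DC'. DC' \<subset> digraph_constraints P m l \<and>
        acyclic_constraints (pverts P) DC' \<and>
        ereal c * polymat (pverts P) (digraph_constraints P m l) \<le> polymat (pverts P) DC' \<and>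
        polymat (pverts P) DC' \<le> ereal C * polymat (pverts P) (digraph_constraints P m l)))"
proof -
  interpret pair_digraph P by fact
  have "parcs P \<subseteq> pverts P \<times> pverts P"
    using in_arcsD1 in_arcsD2 by auto
  then obtain R where R: "root_system (pverts P) (parcs P) R"
    using ex_root_system[of "pverts P" "parcs P"] no_loops' by auto
  then obtain \<rho> :: "'a \<Rightarrow> nat" where \<rho>: "inj_on \<rho> (pverts P)"
    "\<And>y. y \<in> pverts P - R \<Longrightarrow> \<exists>x. (x, y) \<in> parcs P \<and> \<rho> x < \<rho> y"
    using root_system.ex_ranking by blast
  show ?thesis
  \<comment> \<open>The two bounds coincide, so both constants are 1.\<close>
  proof (intro exI[of _ "1::real"] conjI allI impI)
    fix m l :: nat
    let ?D = "digraph_constraints P m l" and ?F = "forward_constraints P \<rho> m l"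
    assume ml: "1 \<le> l" "l \<le> m" and cyc: "cyclic_constraints (pverts P) ?D"
    \<comment> \<open>The inclusion is strict because \<open>?D\<close> is cyclic and
      \<open>?F\<close> is not.\<close>
    have "?F \<subset> ?D"
      using forward_constraints_subset cyc acyclic_forward_constraints by (metis psubsetI)
    moreover have "polymat (pverts P) ?D \<le> polymat (pverts P) ?F"
      by (intro polymat_antimono forward_constraints_subset)
    ultimately show "\<exists>DC'. DC' \<subset> ?D \<and> acyclic_constraints (pverts P) DC' \<and>
        ereal 1 * polymat (pverts P) ?D \<le> polymat (pverts P) DC' \<and>
        polymat (pverts P) DC' \<le> ereal 1 * polymat (pverts P) ?D"
      using polymat_forward_constraints_le[OF assms(1) R \<rho> ml] acyclic_forward_constraints
      by (intro exI[of _ ?F]) (simp flip: one_ereal_def)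
  qed simp_all
qed

end
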